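(* There are $\beta$-normalized LCL problems (on globally oriented paths) that can be solved in constant time but whose distributed time complexity is $2^{\Omega(\beta)}$. That is, there are a constant $c>0$ and $\beta$-normalized LCL problems for arbitrarily large $\beta$ such that each of these problems can be solved in the $\mathsf{LOCAL}$ model in a number of rounds that is independent of the number $n$ of nodes, but this number of rounds has to be at least $2^{c\beta}$.
   Context: **LOCAL model.** Each node of the $n$-node input graph is a computational entity with a globally unique identifier (a bit string of length $O(\log n)$); initially each node knows its own ID, $n$, the maximum degree, and its input label. In each synchronous round every node exchanges messages of arbitrary size with its neighbors and does arbitrary local computation. All nodes run the same algorithm and each finally outputs a label. Equivalently, a $T(n)$-round algorithm is a function mapping radius-$T(n)$ neighborhoods to output labels. The time complexity of a problem is the minimum worst-case number of rounds. A globally oriented path is a directed path $p_0,\dots,p_{n-1}$ in which every node knows which neighbor is its predecessor and which is its successor. **$\beta$-normalized LCL.** A $\beta$-normalized LCL problem on directed paths is given by finite label sets $\Sigma_{\mathrm{in}},\Sigma_{\mathrm{out}}$ with $|\Sigma_{\mathrm{in}}|=2$ and $|\Sigma_{\mathrm{out}}|=\beta$, a set $\mathcal{C}_{\mathrm{in-out}}\subseteq\Sigma_{\mathrm{in}}\times\Sigma_{\mathrm{out}}$, and a set $\mathcal{C}_{\mathrm{out-out}}\subseteq\Sigma_{\mathrm{out}}\times\Sigma_{\mathrm{out}}$. Each node $v$ receives an input label $\mathrm{Input}(v)\in\Sigma_{\mathrm{in}}$ and must produce an output label $\mathrm{Output}(v)\in\Sigma_{\mathrm{out}}$. The output is correct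 if (i) $(\mathrm{Input}(v),\mathrm{Output}(v))\in\mathcal{C}_{\mathrm{in-out}}$ for each node $v$, and (ii) $(\mathrm{Output}(v),\mathrm{Output}(u))\in\mathcal{C}_{\mathrm{out-out}}$ for each node $v$ that has a predecessor $u$. *)

theory Defs
  imports Complex_Main "HOL-Library.Landau_Symbols"
begin

section \<open>LCL problems on directed paths\<close>

record ('i, 'o) lcl =
  Sigma_in :: "'i set"
  Sigma_out :: "'o set"
  C_in_out :: "('i \<times> 'o) set"
  C_out_out :: "('o \<times> 'o) set"

definition beta_normalized :: "nat \<Rightarrow> ('i, 'o) lcl \<Rightarrow> bool" where
  "beta_normalized \<beta> P \<longleftrightarrow>
     finite (Sigma_in P) \<and> card (Sigma_in P) = 2 \<and>
     finite (Sigma_out P) \<and> card (Sigma_out P) = \<beta> \<and>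
     C_in_out P \<subseteq> Sigma_in P \<times> Sigma_out P \<and>
     C_out_out P \<subseteq> Sigma_out P \<times> Sigma_out P"

text \<open>The nodes of the \<open>n\<close>-node path are the numbers below \<open>n\<close>, and the predecessor of
  \<open>Suc v\<close> is \<open>v\<close>. Labellings are functions on all of \<open>nat\<close>; only their values below \<open>n\<close> matter.
  In a pair of \<open>C_out_out\<close> the label of the predecessor is the second component.\<close>

definition correct_output ::
    "('i, 'o) lcl \<Rightarrow> nat \<Rightarrow> (nat \<Rightarrow> 'i) \<Rightarrow> (nat \<Rightarrow> 'o) \<Rightarrow> bool" where
  "correct_output P n inp out \<longleftrightarrow>
     (\<forall>v<n. (inp v, out v) \<in> C_in_out P) \<and>
     (\<forall>u. Suc u < n \<longrightarrow> (out (Suc u), out u) \<in> C_out_out P)"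


section \<open>The LOCAL model on globally oriented paths\<close>

text \<open>Identifiers on an \<open>n\<close>-node path are bit strings of length \<open>L n = O(log n)\<close>. The second
  condition says that there are enough of them for \<open>n\<close> nodes.\<close>

definition id_length :: "(nat \<Rightarrow> nat) \<Rightarrow> bool" where
  "id_length L \<longleftrightarrow> (\<lambda>n. real (L n)) \<in> O(\<lambda>n. ln (real n)) \<and> (\<forall>n\<ge>1. n \<le> 2 ^ L n)"

definition valid_ids :: "nat \<Rightarrow> nat \<Rightarrow> (nat \<Rightarrow> bool list) \<Rightarrow> bool" where
  "valid_ids l n ids \<longleftrightarrow> inj_on ids {..<n} \<and> (\<forall>v<n. length (ids v) = l)"

text \<open>What a node knows before the first round, apart from \<open>n\<close>. The maximum degree of a path is
  determined by \<open>n\<close>. As a node can tell its predecessor from its successor, it also knows which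
  of the two exist.\<close>

record 'i node_info =
  node_id :: "bool list"
  node_input :: 'i
  has_pred :: bool
  has_succ :: bool

definition node_info_at ::
    "nat \<Rightarrow> (nat \<Rightarrow> bool list) \<Rightarrow> (nat \<Rightarrow> 'i) \<Rightarrow> nat \<Rightarrow> 'i node_info" where
  "node_info_at n ids inp v =
     \<lparr>node_id = ids v, node_input = inp v, has_pred = (0 < v), has_succ = (Suc v < n)\<rparr>"

text \<open>The radius-\<open>t\<close> neighbourhood of \<open>v\<close>, indexed by the signed distance from \<open>v\<close>, so that an
  algorithm sees relative positions only and not \<open>v\<close> itself.\<close>

type_synonym 'i neighbourhood = "int \<Rightarrow> 'i node_info option"

definition neighbourhood ::
    "nat \<Rightarrow> nat \<Rightarrow> (nat \<Rightarrow> bool list) \<Rightarrow> (nat \<Rightarrow> 'i) \<Rightarrow> nat \<Rightarrow> 'i neighbourhood" where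
  "neighbourhood t n ids inp v = (\<lambda>d.
     if \<bar>d\<bar> \<le> int t \<and> 0 \<le> int v + d \<and> int v + d < int n
     then Some (node_info_at n ids inp (nat (int v + d)))
     else None)"

text \<open>The first argument of an algorithm is the number \<open>n\<close> of nodes.\<close>

type_synonym ('i, 'o) algorithm = "nat \<Rightarrow> 'i neighbourhood \<Rightarrow> 'o"

definition solves ::
    "(nat \<Rightarrow> nat) \<Rightarrow> ('i, 'o) lcl \<Rightarrow> (nat \<Rightarrow> nat) \<Rightarrow> ('i, 'o) algorithm \<Rightarrow> bool" where
  "solves L P T A \<longleftrightarrow>
     (\<forall>n\<ge>1. \<forall>ids inp. valid_ids (L n) n ids \<and> (\<forall>v<n. inp v \<in> Sigma_in P) \<longrightarrow>
        correct_output P n inp (\<lambda>v. A n (neighbourhood (T n) n ids inp v)))"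

definition solvable_in_rounds ::
    "(nat \<Rightarrow> nat) \<Rightarrow> ('i, 'o) lcl \<Rightarrow> (nat \<Rightarrow> nat) \<Rightarrow> bool" where
  "solvable_in_rounds L P T \<longleftrightarrow> (\<exists>A. solves L P T A)"

end

theory Submission
  imports Defs "HOL-Library.Countable"
begin

text \<open>Two consecutive input bits 1 form a reset, and the bit before them is a secret that must be
  carried along the path until the input violates the rules of a binary counter. Relative to the
  last reset the input is cut into rows of length \<open>p = 2 * k\<close>, whose even positions hold the
  digits of a number, lowest digit first. From one row to the next, the first digit 0 has to become
  1 and the higher digits have to stay, while the lower digits and the odd positions are free.
  The numbers in the rows then increase strictly, so that a violation or a row without a digit 0
  occurs within \<open>2 ^ k\<close> rows. A violation concerns two positions at distance \<open>p\<close>, so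
  \<open>O(p)\<close> labels suffice to certify it, and a certificate makes the label \<open>Garbage\<close> available.
  As \<open>Garbage\<close> persists up to the next reset, no symmetry has to be broken between
  overlapping violations, and a constant radius suffices. On the input that really counts,
  the secret must be carried over exponentially many rows.\<close>

section \<open>The modes, labels and rules of the counter problem\<close>

text \<open>In \<open>Carry s i z\<close>, \<open>s\<close> is the secret, \<open>i\<close> the phase of the next position in its row, and \<open>z\<close> tells
  whether the current row has shown a digit 0 so far. \<open>Check j e\<close> claims that the input bit at distance
  \<open>p - j\<close> ahead is \<open>e\<close>, which is a violation.\<close>

datatype mode = Garbage | is_Carry: Carry bool nat bool | Check nat bool

instance mode :: countable
  by countable_datatype

text \<open>The input bit of the predecessor, the own input bit, and the mode.\<close>

type_synonym label = "bool \<times> bool \<times> mode"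

text \<open>After a bit is read, \<open>i\<close> and \<open>z\<close> speak of the next position,
  so \<open>z\<close> is cleared when that position opens a new row.\<close>

definition carry_step :: "nat \<Rightarrow> bool \<Rightarrow> nat \<Rightarrow> bool \<Rightarrow> bool \<Rightarrow> mode" where
  "carry_step p s i z c =
     Carry s (Suc i mod p) (Suc i mod p \<noteq> 0 \<and> (z \<or> even i \<and> \<not> c))"

text \<open>A check can start only at a digit that prescribes its counterpart in the next row. There
  \<open>z \<and> \<not> c\<close> is the wrong value: 0 for the first digit 0, the negated digit
  for the higher ones. The last option of \<open>Carry\<close> reports overflow.\<close>

fun mode_step :: "nat \<Rightarrow> mode \<Rightarrow> bool \<Rightarrow> mode \<Rightarrow> bool" where
  "mode_step p Garbage c m \<longleftrightarrow> m = Garbage"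
| "mode_step p (Carry s i z) c m \<longleftrightarrow>
     m = carry_step p s i z c \<or>
     even i \<and> (z \<or> \<not> c) \<and> m = Check 0 (z \<and> \<not> c) \<or>
     Suc i = p \<and> \<not> z \<and> m = Garbage"
| "mode_step p (Check j e) c m \<longleftrightarrow>
     (if Suc j < p then m = Check (Suc j) e else m = Garbage \<and> c = e)"

text \<open>The first field exists to hand the secret, two places before the second 1, to the reset.
  A reset overrides every mode, even a check in progress.\<close>

fun label_step :: "nat \<Rightarrow> label \<Rightarrow> label \<Rightarrow> bool" where
  "label_step p (a, b, m) (a', b', m') \<longleftrightarrow>
     a' = b \<and> (if b \<and> b' then m' = Carry a 1 False else mode_step p m b' m')"

definition modes :: "nat \<Rightarrow> mode set" where
  "modes p = insert Garbage
     ((\<lambda>(s, i, z). Carry s i z) ` (UNIV \<times> {..<p} \<times> UNIV) \<union>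
      (\<lambda>(j, e). Check j e) ` ({..<p} \<times> UNIV))"

definition labels :: "nat \<Rightarrow> label set" where
  "labels p = UNIV \<times> UNIV \<times> modes p"

text \<open>\<open>to_nat\<close> is applied since the theorem asks for output labels in
  \<open>nat\<close>.\<close>

definition counter_lcl :: "nat \<Rightarrow> (nat, nat) lcl" where
  "counter_lcl p =
     \<lparr>Sigma_in = {0, 1}, Sigma_out = to_nat ` labels p,
      C_in_out = {(i, to_nat l) | i l. i \<in> {0, 1} \<and> l \<in> labels p \<and> fst (snd l) = (i = 1)},
      C_out_out = {(to_nat l', to_nat l) | l l'. l \<in> labels p \<and> l' \<in> labels p \<and> label_step p l l'}\<rparr>"

lemma modes_simps [simp]:
  "Garbage \<in> modes p"
  "Carry s i z \<in> modes p \<longleftrightarrow> i < p"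
  "Check j e \<in> modes p \<longleftrightarrow> j < p"
  by (auto simp: modes_def image_iff)

lemma finite_modes: "finite (modes p)"
  by (simp add: modes_def)

lemma card_modes: "card (modes p) = 6 * p + 1"
proof -
  let ?A = "(\<lambda>(s, i, z). Carry s i z) ` (UNIV \<times> {..<p} \<times> UNIV)"
  let ?B = "(\<lambda>(j, e). Check j e) ` ({..<p} \<times> UNIV)"
  have "card ?A = 4 * p" "card ?B = 2 * p"
    by (subst card_image; force simp: inj_on_def card_cartesian_product)+
  moreover have "card (?A \<union> ?B) = card ?A + card ?B"
    by (rule card_Un_disjoint) auto
  moreover have "Garbage \<notin> ?A \<union> ?B" "finite (?A \<union> ?B)"
    by auto
  ultimately show ?thesis
    by (simp add: modes_def)
qed

lemma beta_normalized_counter_lcl: "beta_normalized (24 * p + 4) (counter_lcl p)"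
proof -
  have "card (to_nat ` labels p) = card (labels p)"
    by (rule card_image) (rule inj_on_subset[OF inj_to_nat subset_UNIV])
  also have "\<dots> = 24 * p + 4"
    by (simp add: labels_def card_cartesian_product card_modes)
  finally show ?thesis
    by (auto simp: beta_normalized_def counter_lcl_def labels_def finite_modes)
qed

section \<open>Solvability in constant time\<close>

text \<open>A deterministic choice among the modes allowed by \<open>mode_step\<close>: a check is started only if it will
  succeed, which the additional bit \<open>c'\<close> at distance \<open>p\<close> ahead of \<open>c\<close> tells.\<close>

fun next_mode :: "nat \<Rightarrow> mode \<Rightarrow> bool \<Rightarrow> bool \<Rightarrow> mode" where
  "next_mode p Garbage c c' = Garbage"
| "next_mode p (Carry s i z) c c' =
     (if even i \<and> (z \<or> \<not> c) \<and> c' = (z \<and> \<not> c) then Check 0 (z \<and> \<not> c)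
      else if Suc i = p \<and> \<not> z then Garbage else carry_step p s i z c)"
| "next_mode p (Check j e) c c' = (if Suc j < p then Check (Suc j) e else Garbage)"

text \<open>\<open>y\<close> is the input from the second 1 of the reset on. That 1 is the lowest
  digit of row 0, hence the initial phase 1.\<close>

fun run :: "nat \<Rightarrow> bool \<Rightarrow> (nat \<Rightarrow> bool) \<Rightarrow> nat \<Rightarrow> mode" where
  "run p s y 0 = Carry s 1 False"
| "run p s y (Suc d) = next_mode p (run p s y d) (y (Suc d)) (y (Suc d + p))"

lemma run_cong: "(\<And>j. j \<le> d + p \<Longrightarrow> y j = y' j) \<Longrightarrow> run p s y d = run p s y' d"
  by (induction d) auto

lemma next_mode_in_modes: "p > 0 \<Longrightarrow> m \<in> modes p \<Longrightarrow> next_mode p m c c' \<in> modes p"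
  by (cases m) (auto simp: carry_step_def)

lemma run_in_modes: "p > 1 \<Longrightarrow> run p s y d \<in> modes p"
  by (induction d) (auto intro: next_mode_in_modes)

text \<open>The bit looked up when the check started, \<open>j\<close> positions earlier, is the one
  it claims. This makes its final step to \<open>Garbage\<close> legal.\<close>

lemma run_Check: "run p s y d = Check j e \<Longrightarrow> j \<le> d \<and> y (d - j + p) = e"
proof (induction d arbitrary: j)
  case (Suc d)
  then show ?case
    by (cases "run p s y d") (auto simp: carry_step_def split: if_splits)
qed simp

lemma mode_step_run:
  assumes "p > 1"
  shows "mode_step p (run p s y d) (y (Suc d)) (run p s y (Suc d))"
proof (cases "run p s y d")
  case (Check j e)
  have "y (d - j + p) = e" "j \<le> d"
    using run_Check[OF Check] by auto
  moreover have "j < p"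
    using run_in_modes[OF assms, of s y d] Check by simp
  ultimately have "Suc j = p \<Longrightarrow> y (Suc d) = e"
    by (metis add_Suc_right le_add_diff_inverse2)
  then show ?thesis
    using Check \<open>j < p\<close> by auto
qed auto

text \<open>The value \<open>z\<close> must have just before position \<open>d\<close> is read,
  given by the input alone, so that it serves both \<open>run\<close> and arbitrary legal
  labellings.\<close>

definition zero_seen :: "nat \<Rightarrow> (nat \<Rightarrow> bool) \<Rightarrow> nat \<Rightarrow> bool" where
  "zero_seen p y d \<longleftrightarrow> (\<exists>q<d. q div p = d div p \<and> even q \<and> \<not> y q)"

lemma zero_seen_Suc:
  assumes "p > 0"
  shows "zero_seen p y (Suc d) \<longleftrightarrow> Suc d mod p \<noteq> 0 \<and> (zero_seen p y d \<or> even d \<and> \<not> y d)"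
proof (cases "Suc d mod p = 0")
  case True
  then have "q div p < Suc d div p" if "q < Suc d" for q
    using that by (intro less_mult_imp_div_less) (simp add: mod_0_imp_dvd)
  then show ?thesis
    using True unfolding zero_seen_def by fastforce
next
  case False
  then have "Suc d div p = d div p"
    by (simp add: div_Suc)
  then show ?thesis
    using False by (auto simp: zero_seen_def less_Suc_eq)
qed

lemma zero_seen_iff:
  assumes "even p" "i < p"
  shows "zero_seen p y (p * r + i) \<longleftrightarrow> (\<exists>j. 2 * j < i \<and> \<not> y (p * r + 2 * j))"
proof
  assume "zero_seen p y (p * r + i)"
  moreover have "(p * r + i) div p = r"
    using assms by simp
  ultimately obtain q where q: "q < p * r + i" "q div p = r" "even q" "\<not> y q"
    by (auto simp: zero_seen_def)
  then have "q = p * r + q mod p"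
    by (metis mult_div_mod_eq)
  moreover have "even (q mod p)"
    using q assms by (simp add: dvd_mod_iff)
  ultimately show "\<exists>j. 2 * j < i \<and> \<not> y (p * r + 2 * j)"
    using q by (metis dvdE nat_add_left_cancel_less)
next
  assume "\<exists>j. 2 * j < i \<and> \<not> y (p * r + 2 * j)"
  then obtain j where j: "2 * j < i" "\<not> y (p * r + 2 * j)"
    by blast
  then show "zero_seen p y (p * r + i)"
    unfolding zero_seen_def using assms by (intro exI[of _ "p * r + 2 * j"]) auto
qed

lemma carry_step_zero_seen:
  assumes "p > 0" "even p"
  shows "carry_step p s (d mod p) (zero_seen p y d) (y d) = Carry s (Suc d mod p) (zero_seen p y (Suc d))"
proof -
  have "even (d mod p) = even d"
    using assms by (simp add: dvd_mod_iff)
  then show ?thesis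
    using assms by (simp add: carry_step_def zero_seen_Suc mod_Suc_eq)
qed


lemma run_CarryD:
  assumes p: "p > 1" "even p" and y: "y 0" and "run p s y d = Carry s' i z"
  shows "s' = s \<and> i = Suc d mod p \<and> z = zero_seen p y (Suc d)"
  using assms(4)
proof (induction d arbitrary: s' i z)
  case 0
  then show ?case
    using p y by (auto simp: zero_seen_def)
next
  case (Suc d)
  then obtain s1 i1 z1 where r: "run p s y d = Carry s1 i1 z1"
    by (cases "run p s y d") (auto split: if_splits)
  show ?case
    using Suc.prems Suc.IH[OF r] r carry_step_zero_seen[of p s "Suc d" y] p
    by (auto split: if_splits)
qed

text \<open>\<open>next_mode\<close> leaves \<open>Carry\<close> at the first opportunity, so
  staying in it means that the input obeys the row rules here.\<close>

lemma run_carry_Suc: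
  assumes p: "p > 1" "even p" and y: "y 0" and "is_Carry (run p s y (Suc d))"
  shows "even (Suc d) \<Longrightarrow> zero_seen p y (Suc d) \<or> \<not> y (Suc d) \<Longrightarrow>
           y (Suc d + p) \<noteq> (zero_seen p y (Suc d) \<and> \<not> y (Suc d))"
    and "Suc (Suc d mod p) = p \<Longrightarrow> zero_seen p y (Suc d)"
proof -
  obtain s1 i1 z1 where r: "run p s y d = Carry s1 i1 z1"
    using assms(4) by (cases "run p s y d") (auto split: if_splits)
  have "even (Suc d mod p) = even (Suc d)"
    using p by (simp add: dvd_mod_iff)
  with run_CarryD[of p y s d, OF p y r] assms(4) r
  show "even (Suc d) \<Longrightarrow> zero_seen p y (Suc d) \<or> \<not> y (Suc d) \<Longrightarrow>
           y (Suc d + p) \<noteq> (zero_seen p y (Suc d) \<and> \<not> y (Suc d))"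
    and "Suc (Suc d mod p) = p \<Longrightarrow> zero_seen p y (Suc d)"
    by (auto split: if_splits)
qed

section \<open>Growth of the row values and the end of carrying\<close>

definition val :: "nat \<Rightarrow> (nat \<Rightarrow> bool) \<Rightarrow> nat" where
  "val k b = (\<Sum>j<k. of_bool (b j) * 2 ^ j)"

lemma val_upper: "val k b < 2 ^ k"
  by (induction k) (auto simp: val_def)

text \<open>The digits below \<open>j0\<close> sum to less than \<open>2 ^ j0\<close>, which is why
  the rules can leave them free.\<close>

lemma val_less:
  assumes "j0 < k" "\<not> b j0" "b' j0" "\<And>j. j0 < j \<Longrightarrow> j < k \<Longrightarrow> b j = b' j"
  shows "val k b < val k b'"
  using assms
proof (induction k)
  case (Suc k)
  show ?case
  proof (cases "j0 = k")
    case True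
    then show ?thesis
      using Suc.prems val_upper[of k b] by (simp add: val_def)
  next
    case False
    then have "val k b < val k b'" "b k = b' k"
      using Suc by auto
    then show ?thesis
      by (simp add: val_def)
  qed
qed simp

lemma row_increase:
  assumes k: "k > 0" and p: "p = 2 * k" and y: "y 0"
    and carry: "\<And>d. d < p * Suc r \<Longrightarrow> is_Carry (run p s y d)"
  shows "val k (\<lambda>j. y (p * r + 2 * j)) < val k (\<lambda>j. y (p * Suc r + 2 * j))"
proof -
  have p': "p > 1" "even p"
    using k p by auto
  have step: "y (d + p) \<noteq> (zero_seen p y d \<and> \<not> y d)"
    if "d < p * Suc r" "even d" "zero_seen p y d \<or> \<not> y d" for d
  proof (cases d)
    case 0
    with that y show ?thesis by (simp add: zero_seen_def)
  next
    case (Suc d')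
    with that run_carry_Suc(1)[of p y s d', OF p' y] carry[of d] show ?thesis by auto
  qed
  note seen = zero_seen_iff[OF p'(2), of _ y r]
  \<comment> \<open>No overflow at the last position of the row yields a digit 0; the lowest one,
    \<open>j0\<close>, is the digit that flips.\<close>
  have "zero_seen p y (p * r + (p - 1))"
  proof -
    obtain d where d: "Suc d = p * r + (p - 1)"
      using p' by (metis add_gr_0 gr0_implies_Suc zero_less_diff)
    have "(p * r + (p - 1)) mod p = p - 1"
      using p' by (subst mod_mult_self4) simp
    then have "Suc (Suc d mod p) = p" "Suc d < p * Suc r"
      unfolding d using p' by auto
    then show ?thesis
      using run_carry_Suc(2)[of p y s d, OF p' y carry] d by metis
  qed
  then obtain j1 where j1: "2 * j1 < p - 1" "\<not> y (p * r + 2 * j1)"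
    using seen[of "p - 1"] p' by auto
  define j0 where "j0 = (LEAST j. \<not> y (p * r + 2 * j))"
  have j0: "\<not> y (p * r + 2 * j0)" "j0 \<le> j1" "\<And>j. j < j0 \<Longrightarrow> y (p * r + 2 * j)"
    unfolding j0_def using j1(2)
    by (rule LeastI, intro Least_le) (use not_less_Least in blast)+
  have less: "j0 < k"
    using j0(2) j1(1) p by linarith
  show ?thesis
  proof (rule val_less[OF less])
    show "\<not> y (p * r + 2 * j0)" by fact
    have "\<not> zero_seen p y (p * r + 2 * j0)"
      using seen[of "2 * j0"] less p j0(3) by auto
    then show "y (p * Suc r + 2 * j0)"
      using step[of "p * r + 2 * j0"] less p j0(1) by (simp add: algebra_simps)
  next
    fix j assume j: "j0 < j" "j < k"
    then have "zero_seen p y (p * r + 2 * j)"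
      using seen[of "2 * j"] p j0(1) by auto
    then show "y (p * r + 2 * j) = y (p * Suc r + 2 * j)"
      using step[of "p * r + 2 * j"] j p by (simp add: algebra_simps)
  qed
qed

text \<open>Row \<open>r\<close> has value at least \<open>r\<close>, impossible for
  \<open>r = 2 ^ k\<close>. Thanks to the look-ahead, \<open>row_increase\<close> bounds row
  \<open>Suc r\<close> although carrying is assumed only through row \<open>r\<close>.\<close>

lemma run_leaves_Carry:
  assumes k: "k > 0" and p: "p = 2 * k" and y: "y 0"
  shows "\<exists>d < p * 2 ^ k. \<not> is_Carry (run p s y d)"
proof (rule ccontr)
  assume "\<not> ?thesis"
  then have carry: "is_Carry (run p s y d)" if "d < p * 2 ^ k" for d
    using that by blast
  have "r \<le> val k (\<lambda>j. y (p * r + 2 * j))" if "r \<le> 2 ^ k" for r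
    using that
  proof (induction r)
    case (Suc r)
    have "p * Suc r \<le> p * 2 ^ k"
      using Suc.prems by (intro mult_left_mono) auto
    then have "val k (\<lambda>j. y (p * r + 2 * j)) < val k (\<lambda>j. y (p * Suc r + 2 * j))"
      by (intro row_increase[where y = y, OF k p y, of r s] carry) linarith
    with Suc show ?case by linarith
  qed simp
  from this[of "2 ^ k"] val_upper[of k] show False
    by (simp add: not_le[symmetric])
qed

lemma run_Garbage_mono: "run p s y d = Garbage \<Longrightarrow> run p s y (d + i) = Garbage"
  by (induction i) auto

lemma run_Check_add:
  "run p s y d = Check j e \<Longrightarrow> j < p \<Longrightarrow>
     run p s y (d + i) = (if j + i < p then Check (j + i) e else Garbage)"
  by (induction i) (auto split: if_splits)

text \<open>Once carrying ends, a pending check takes at most \<open>p\<close> further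
  positions.\<close>

lemma run_Garbage:
  assumes k: "k > 0" and p: "p = 2 * k" and y: "y 0" and "p * 2 ^ k + p \<le> d"
  shows "run p s y d = Garbage"
proof -
  obtain d0 where d0: "d0 < p * 2 ^ k" "\<not> is_Carry (run p s y d0)"
    using run_leaves_Carry[of k p y s, OF k p y] by blast
  have "run p s y (d0 + p) = Garbage"
  proof (cases "run p s y d0")
    case (Check j e)
    moreover have "j < p"
      using run_in_modes[of p s y d0] k p Check by simp
    ultimately show ?thesis
      using run_Check_add[OF Check, of p] by simp
  qed (use d0 run_Garbage_mono in auto)
  from run_Garbage_mono[OF this, of "d - (d0 + p)"] show ?thesis
    using d0 assms(4) by simp
qed


section \<open>Labels computed from a window of constant radius\<close>

definition reset :: "(int \<Rightarrow> bool) \<Rightarrow> int \<Rightarrow> bool" where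
  "reset x v \<longleftrightarrow> x (v - 1) \<and> x v"

text \<open>Labellings of all integers by window maps: positions outside the path count as input 0.
  A reset more than \<open>w\<close> positions behind may be ignored because \<open>run\<close> has reached \<open>Garbage\<close> by then.\<close>

definition mode_at :: "nat \<Rightarrow> nat \<Rightarrow> (int \<Rightarrow> bool) \<Rightarrow> int \<Rightarrow> mode" where
  "mode_at p w x v =
     (if \<exists>d\<le>w. reset x (v - int d)
      then let d = (LEAST d. reset x (v - int d))
           in run p (x (v - int d - 2)) (\<lambda>j. x (v - int d + int j)) d
      else Garbage)"

definition label_at :: "nat \<Rightarrow> nat \<Rightarrow> (int \<Rightarrow> bool) \<Rightarrow> int \<Rightarrow> label" where
  "label_at p w x v = (x (v - 1), x v, mode_at p w x v)"

lemma mode_at_eq: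
  assumes "reset x (v - int d)" "d \<le> w" "\<And>d'. d' < d \<Longrightarrow> \<not> reset x (v - int d')"
  shows "mode_at p w x v = run p (x (v - int d - 2)) (\<lambda>j. x (v - int d + int j)) d"
proof -
  have "(LEAST d. reset x (v - int d)) = d"
    using assms by (intro Least_equality) (auto simp: not_less[symmetric])
  then show ?thesis
    using assms by (auto simp: mode_at_def Let_def)
qed

lemma mode_at_cases:
  obtains (reset) d where "reset x (v - int d)" "d \<le> w" "\<And>d'. d' < d \<Longrightarrow> \<not> reset x (v - int d')"
  | (none) "\<And>d. d \<le> w \<Longrightarrow> \<not> reset x (v - int d)"
proof (cases "\<exists>d\<le>w. reset x (v - int d)")
  case True
  then obtain d1 where "reset x (v - int d1)" "d1 \<le> w"
    by blast
  then show thesis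
    using LeastI[of "\<lambda>d. reset x (v - int d)" d1] Least_le[of "\<lambda>d. reset x (v - int d)" d1]
      not_less_Least[of _ "\<lambda>d. reset x (v - int d)"]
    by (intro reset[of "LEAST d. reset x (v - int d)"]) auto
qed (use none in blast)

lemma label_at_local:
  assumes z: "\<And>d. \<bar>d\<bar> \<le> int (w + p + 2) \<Longrightarrow> z d = x (v + d)"
  shows "label_at p w z 0 = label_at p w x v"
proof -
  have r: "reset z (0 - int d) = reset x (v - int d)" if "d \<le> w" for d
    using that z[of "- int d"] z[of "- int d - 1"] by (simp add: reset_def algebra_simps)
  have "mode_at p w z 0 = mode_at p w x v"
  proof (cases rule: mode_at_cases[of x v w])
    case (reset d)
    have "run p (z (- int d - 2)) (\<lambda>j. z (- int d + int j)) d =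
          run p (x (v - int d - 2)) (\<lambda>j. x (v - int d + int j)) d"
    proof -
      have "z (- int d - 2) = x (v - int d - 2)"
        using reset(2) z[of "- int d - 2"] by (simp add: algebra_simps)
      moreover have "z (- int d + int j) = x (v - int d + int j)" if "j \<le> d + p" for j
        using that reset(2) z[of "- int d + int j"] by (simp add: algebra_simps)
      ultimately show ?thesis
        using run_cong[of d p "\<lambda>j. z (- int d + int j)"] by simp
    qed
    moreover have "\<not> reset z (0 - int d')" if "d' < d" for d'
      using r[of d'] reset(2) reset(3)[OF that] that by simp
    ultimately show ?thesis
      using mode_at_eq[of x v d w p] mode_at_eq[of z 0 d w p] r[of d] reset by simp
  next
    case none
    with r show ?thesis
      by (auto simp: mode_at_def)
  qed
  then show ?thesis
    using z[of 0] z[of "- 1"] by (simp add: label_at_def)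
qed

lemma label_at_in_labels: "p > 1 \<Longrightarrow> label_at p w x v \<in> labels p"
  by (simp add: label_at_def labels_def mode_at_def Let_def run_in_modes)

lemma label_step_label_at:
  assumes k: "k > 0" and p: "p = 2 * k" and w: "w = p * 2 ^ k + p"
  shows "label_step p (label_at p w x v) (label_at p w x (v + 1))"
proof (cases "reset x (v + 1)")
  case True
  then have "mode_at p w x (v + 1) = Carry (x (v - 1)) 1 False"
    using mode_at_eq[of x "v + 1" 0 w p] by simp
  with True show ?thesis
    by (simp add: label_at_def reset_def)
next
  case False
  have p': "p > 1"
    using k p by simp
  have "mode_step p (mode_at p w x v) (x (v + 1)) (mode_at p w x (v + 1))"
  proof (cases rule: mode_at_cases[of x v w])
    case (reset d)
    let ?s = "x (v - int d - 2)" and ?y = "\<lambda>j. x (v - int d + int j)"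
    have m: "mode_at p w x v = run p ?s ?y d"
      using mode_at_eq reset by blast
    have nr: "\<not> reset x (v + 1 - int d')" if "d' < Suc d" for d'
      using that False reset(3)[of "d' - 1"] by (cases d') auto
    show ?thesis
    proof (cases "d = w")
      \<comment> \<open>The reset is about to drop out of the window; both modes are
        \<open>Garbage\<close>.\<close>
      case True
      have "?y 0"
        using reset by (simp add: reset_def)
      then have "run p ?s ?y w = Garbage"
        by (intro run_Garbage[OF k p]) (auto simp: w)
      moreover have "mode_at p w x (v + 1) = Garbage"
        using nr True by (auto simp: mode_at_def)
      ultimately show ?thesis
        using m True by simp
    next
      case False
      then have "mode_at p w x (v + 1) = run p ?s ?y (Suc d)"
        using mode_at_eq[of x "v + 1" "Suc d" w p] reset nr by simp
      then show ?thesis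
        using m mode_step_run[OF p', of ?s ?y d] by (simp add: algebra_simps)
    qed
  next
    case none
    have "\<not> reset x (v + 1 - int d)" if "d \<le> w" for d
      using that False none[of "d - 1"] by (cases d) auto
    with none show ?thesis
      by (auto simp: mode_at_def)
  qed
  with False show ?thesis
    by (auto simp: label_at_def reset_def)
qed

lemma solvable_counter_lcl:
  assumes k: "k > 0" and p: "p = 2 * k"
  shows "\<exists>t. solvable_in_rounds L (counter_lcl p) (\<lambda>n. t)"
proof -
  define w where "w = p * 2 ^ k + p"
  \<comment> \<open>The secret lies up to \<open>w + 2\<close> positions behind, the look-ahead bit
    \<open>p\<close> positions ahead.\<close>
  define R where "R = w + p + 2"
  define A :: "(nat, nat) algorithm" where
    "A = (\<lambda>n N. to_nat (label_at p w
        (\<lambda>d. case N d of None \<Rightarrow> False | Some i \<Rightarrow> node_input i = 1) 0))"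
  have "correct_output (counter_lcl p) n inp (\<lambda>v. A n (neighbourhood R n ids inp v))"
    if inp: "\<forall>v<n. inp v \<in> {0, 1}" for n ids inp
  proof -
    define x where "x u \<longleftrightarrow> 0 \<le> u \<and> u < int n \<and> inp (nat u) = 1" for u
    have A: "A n (neighbourhood R n ids inp v) = to_nat (label_at p w x (int v))" for v
      unfolding A_def
      by (rule arg_cong[where f = to_nat], rule label_at_local)
        (auto simp: neighbourhood_def node_info_at_def x_def R_def)
    have p': "p > 1"
      using k p by simp
    show ?thesis
      unfolding correct_output_def A
    proof (intro conjI allI impI)
      fix v assume "v < n"
      then have "fst (snd (label_at p w x (int v))) = (inp v = 1)" "inp v \<in> {0, 1}"
        using inp by (auto simp: label_at_def x_def)
      then show "(inp v, to_nat (label_at p w x (int v))) \<in> C_in_out (counter_lcl p)"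
        using label_at_in_labels[OF p', of w x "int v"]
        by (cases "label_at p w x (int v)") (auto simp: counter_lcl_def)
    next
      fix u
      have "int (Suc u) = int u + 1"
        by simp
      then show "(to_nat (label_at p w x (int (Suc u))), to_nat (label_at p w x (int u)))
              \<in> C_out_out (counter_lcl p)"
        using label_at_in_labels[OF p'] label_step_label_at[OF k p w_def, of x "int u"]
        unfolding counter_lcl_def lcl.simps mem_Collect_eq prod.inject by metis
    qed
  qed
  then have "solves L (counter_lcl p) (\<lambda>n. R) A"
    by (simp add: solves_def counter_lcl_def)
  then show ?thesis
    by (auto simp: solvable_in_rounds_def)
qed

section \<open>The lower bound\<close>

text \<open>Row \<open>r\<close> holds the number \<open>r + 1\<close>, since the bit at position 0 is the second 1 of the reset.\<close>

definition counter_word :: "nat \<Rightarrow> nat \<Rightarrow> bool" where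
  "counter_word p d \<longleftrightarrow> even d \<and> bit (Suc (d div p)) (d mod p div 2)"

lemma bit_Suc_nat: "bit (Suc a) j \<longleftrightarrow> bit a j \<noteq> (\<forall>i<j. bit a i)"
proof (induction j arbitrary: a)
  case 0
  then show ?case
    by (simp add: bit_0)
next
  case (Suc j)
  show ?case
  proof (cases "even a")
    case True
    then show ?thesis
      by (auto simp: bit_Suc All_less_Suc2 bit_0)
  next
    case False
    then have "Suc a div 2 = Suc (a div 2)"
      by presburger
    with False show ?thesis
      using Suc by (simp add: bit_Suc All_less_Suc2 bit_0)
  qed
qed

text \<open>Adjacent rows hold consecutive numbers, and by \<open>bit_Suc_nat\<close> a true
  increment obeys the row rules.\<close>

lemma counter_word_no_defect:
  assumes p: "p > 0" "even p" and q: "even q" "zero_seen p (counter_word p) q \<or> \<not> counter_word p q"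
  shows "counter_word p (q + p) \<noteq> (zero_seen p (counter_word p) q \<and> \<not> counter_word p q)"
proof -
  define r where "r = q div p"
  obtain j where j: "q mod p = 2 * j"
    using p q by (metis dvd_mod evenE)
  have q': "q = p * r + 2 * j"
    unfolding r_def j[symmetric] by simp
  have w: "counter_word p (p * r' + 2 * i) = bit (Suc r') i" if "i \<le> j" for r' i
  proof -
    have "2 * i < p"
      using that j p by (metis mod_less_divisor mult_le_mono2 order.strict_trans1)
    then show ?thesis
      using p by (simp add: counter_word_def)
  qed
  have "2 * j < p"
    using j p by (metis mod_less_divisor)
  then have "zero_seen p (counter_word p) q \<longleftrightarrow> (\<exists>i<j. \<not> counter_word p (p * r + 2 * i))"
    unfolding q' using p by (simp add: zero_seen_iff)
  also have "\<dots> \<longleftrightarrow> (\<exists>i<j. \<not> bit (Suc r) i)"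
    using w by auto
  finally have seen: "zero_seen p (counter_word p) q \<longleftrightarrow> (\<exists>i<j. \<not> bit (Suc r) i)" .
  have "q + p = p * Suc r + 2 * j"
    by (simp add: q')
  then have "counter_word p (q + p) = bit (Suc (Suc r)) j" "counter_word p q = bit (Suc r) j"
    using w[of j r] w[of j "Suc r"] q' by (simp_all add: ac_simps)
  then show ?thesis
    using seen q bit_Suc_nat[of "Suc r" j] by auto
qed

text \<open>In these rows the number is below \<open>2 ^ (k - 1)\<close>, so the top digit
  \<open>k - 1\<close> is a 0.\<close>

lemma counter_word_no_overflow:
  assumes k: "k > 0" and p: "p = 2 * k" and q: "Suc (q mod p) = p" "q < p * (2 ^ (k - 1) - 1)"
  shows "zero_seen p (counter_word p) q"
proof -
  define r where "r = q div p"
  have "r < 2 ^ (k - 1) - 1"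
    unfolding r_def using q by (simp add: less_mult_imp_div_less mult.commute)
  then have "Suc r div 2 ^ (k - 1) = 0"
    by simp
  then have "\<not> bit (Suc r) (k - 1)"
    by (simp add: bit_iff_odd)
  moreover have "q mod p = 2 * (k - 1) + 1"
    using q p k by linarith
  then have "q = p * r + (2 * (k - 1) + 1)"
    unfolding r_def by (metis mult_div_mod_eq)
  moreover have "counter_word p (p * r + 2 * (k - 1)) = bit (Suc r) (k - 1)"
    using k p by (simp add: counter_word_def)
  ultimately show ?thesis
    using zero_seen_iff[of p "2 * (k - 1) + 1" "counter_word p" r] k p by auto
qed

section \<open>Legal labellings of the counting input must carry\<close>

text \<open>A check cannot be abandoned, so it reaches the position it speaks of, which
  \<open>d + p \<le> D + j\<close> keeps within range, and fails there.\<close>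

lemma Check_impossible:
  assumes step: "\<And>d. d < D \<Longrightarrow> mode_step p (M d) (y (Suc d)) (M (Suc d))"
    and "M d = Check j e" "j < p" "d + p \<le> D + j" "y (d + p - j) \<noteq> e"
  shows False
  using assms(2-)
proof (induction "p - Suc j" arbitrary: d j)
  case 0
  then have "Suc j = p" "d < D" "d + p - j = Suc d"
    by auto
  with 0 step[of d] show False
    by auto
next
  case (Suc n)
  then have "Suc j < p" "d < D"
    by auto
  with Suc.prems step[of d] have "M (Suc d) = Check (Suc j) e"
    by auto
  moreover have "n = p - Suc (Suc j)"
    using Suc.hyps(2) by arith
  ultimately show False
    using Suc.hyps(1)[of "Suc j" "Suc d"] Suc.prems \<open>Suc j < p\<close> by simp
qed

text \<open>Of the three options of \<open>Carry\<close>, \<open>no_overflow\<close> excludes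
  \<open>Garbage\<close>, and \<open>no_defect\<close> with \<open>Check_impossible\<close> excludes
  a check, as \<open>d + p \<le> D\<close> leaves room for its end.\<close>

lemma Carry_forced:
  assumes p: "p > 1" "even p" and y: "y 0" and M0: "M 0 = Carry s 1 False"
    and step: "\<And>d. d < D \<Longrightarrow> mode_step p (M d) (y (Suc d)) (M (Suc d))"
    and no_defect: "\<And>q. even q \<Longrightarrow> zero_seen p y q \<or> \<not> y q \<Longrightarrow> y (q + p) \<noteq> (zero_seen p y q \<and> \<not> y q)"
    and no_overflow: "\<And>q. Suc (q mod p) = p \<Longrightarrow> q < D \<Longrightarrow> zero_seen p y q"
    and "d + p \<le> D"
  shows "M d = Carry s (Suc d mod p) (zero_seen p y (Suc d))"
  using assms(8)
proof (induction d)
  case 0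
  then show ?case
    using p y M0 by (simp add: zero_seen_def)
next
  case (Suc d)
  let ?z = "zero_seen p y (Suc d)"
  have M: "M d = Carry s (Suc d mod p) ?z"
    using Suc by simp
  have even: "even (Suc d mod p) = even (Suc d)"
    using p by (simp add: dvd_mod_iff)
  have "\<not> (Suc (Suc d mod p) = p \<and> \<not> ?z)"
    using no_overflow[of "Suc d"] Suc.prems p by auto
  moreover have "\<not> (even (Suc d) \<and> (?z \<or> \<not> y (Suc d)) \<and> M (Suc d) = Check 0 (?z \<and> \<not> y (Suc d)))"
    using Check_impossible[of D p M y "Suc d" 0 "?z \<and> \<not> y (Suc d)", OF step] p Suc.prems
      no_defect[of "Suc d"] by auto
  ultimately have "M (Suc d) = carry_step p s (Suc d mod p) ?z (y (Suc d))"
    using step[of d] Suc.prems p unfolding M mode_step.simps even by auto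
  then show ?case
    using carry_step_zero_seen[of p s "Suc d" y] p by simp
qed

text \<open>Node 0 holds the secret, nodes 1 and 2 form the reset: the word starts at node 2 with a
  1.\<close>

definition secret_input :: "nat \<Rightarrow> bool \<Rightarrow> nat \<Rightarrow> nat" where
  "secret_input p s v = of_bool (if v = 0 then s else v = 1 \<or> counter_word p (v - 2))"

lemma correct_output_labels:
  assumes "correct_output (counter_lcl p) n inp out"
  obtains l where "\<And>v. v < n \<Longrightarrow> out v = to_nat (l v) \<and> fst (snd (l v)) = (inp v = 1)"
    and "\<And>u. Suc u < n \<Longrightarrow> label_step p (l u) (l (Suc u))"
proof
  let ?l = "\<lambda>v. from_nat (out v) :: label"
  show "out v = to_nat (?l v) \<and> fst (snd (?l v)) = (inp v = 1)" if "v < n" for v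
  proof -
    have "(inp v, out v) \<in> C_in_out (counter_lcl p)"
      using assms that by (simp add: correct_output_def)
    then show ?thesis
      by (auto simp: counter_lcl_def)
  qed
  show "label_step p (?l u) (?l (Suc u))" if "Suc u < n" for u
  proof -
    have "(out (Suc u), out u) \<in> C_out_out (counter_lcl p)"
      using assms that by (simp add: correct_output_def)
    then show ?thesis
      by (auto simp: counter_lcl_def)
  qed
qed

lemma secret_forced:
  assumes k: "k > 0" and p: "p = 2 * k" and D: "D = p * (2 ^ (k - 1) - 1)"
    and n: "D + 3 \<le> n" and d: "d + p \<le> D"
    and "correct_output (counter_lcl p) n (secret_input p s) out"
  shows "\<exists>(a::bool) (b::bool) i z. out (d + 2) = to_nat (a, b, Carry s i z)"
proof -
  obtain l where l: "\<And>v. v < n \<Longrightarrow> out v = to_nat (l v) \<and> fst (snd (l v)) = (secret_input p s v = 1)"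
    and l_step: "\<And>u. Suc u < n \<Longrightarrow> label_step p (l u) (l (Suc u))"
    using correct_output_labels[OF assms(6)] by blast
  let ?y = "counter_word p"
  define M where "M d = snd (snd (l (d + 2)))" for d
  have p': "p > 1" "even p"
    using k p by auto
  have y0: "?y 0"
    using p' by (simp add: counter_word_def bit_0)
  have lv: "\<exists>a. l (d + 2) = (a, ?y d, M d)" if "d \<le> D" for d
    using l[of "d + 2"] that n by (cases "l (d + 2)") (auto simp: M_def secret_input_def)
  \<comment> \<open>The first field of node 0 is unconstrained, but that of node 1 is
    \<open>s\<close>. If \<open>s\<close> is 1, node 1 is a reset too, which the one at node 2
    overrides.\<close>
  have "M 0 = Carry s 1 False"
  proof -
    obtain a0 m0 where "l 0 = (a0, s, m0)"
      using l[of 0] n by (cases "l 0") (auto simp: secret_input_def)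
    moreover obtain a1 m1 where l1: "l 1 = (a1, True, m1)"
      using l[of 1] n by (cases "l 1") (auto simp: secret_input_def)
    ultimately have "a1 = s"
      using l_step[of 0] n by auto
    then show ?thesis
      using l_step[of 1] l1 lv[of 0] n y0 by (auto simp: numeral_2_eq_2)
  qed
  moreover have "mode_step p (M d) (?y (Suc d)) (M (Suc d))" if dD: "d < D" for d
  proof -
    \<comment> \<open>Odd positions of the word are 0, so no later reset erases the secret.\<close>
    have "\<not> (?y d \<and> ?y (Suc d))"
      by (auto simp: counter_word_def)
    moreover obtain a where "l (d + 2) = (a, ?y d, M d)"
      using lv[of d] dD by auto
    moreover obtain a' where "l (Suc (d + 2)) = (a', ?y (Suc d), M (Suc d))"
      using lv[of "Suc d"] dD by auto
    ultimately show ?thesis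
      using l_step[of "d + 2"] dD n by (simp split: if_splits)
  qed
  ultimately have "M d = Carry s (Suc d mod p) (zero_seen p ?y (Suc d))"
    using counter_word_no_defect[of p] counter_word_no_overflow[OF k p] d p' y0
    by (intro Carry_forced[where D = D]) (auto simp: D)
  then show ?thesis
    using l[of "d + 2"] lv[of d] d n by fastforce
qed

section \<open>Indistinguishability of the two secrets\<close>

lemma valid_ids_exist:
  assumes "id_length L" "n \<ge> 1"
  obtains ids where "valid_ids (L n) n ids"
proof -
  let ?B = "{xs :: bool list. length xs = L n}"
  have "card ?B = 2 ^ L n" "finite ?B"
    using card_lists_length_eq[of "UNIV :: bool set" "L n"] finite_lists_length_eq[of "UNIV :: bool set" "L n"]
    by simp_all
  then have "card {..<n} \<le> card ?B" "finite ?B"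
    using assms by (simp_all add: id_length_def)
  then obtain f where "f ` {..<n} \<subseteq> ?B" "inj_on f {..<n}"
    using card_le_inj[of "{..<n}" ?B] by auto
  then have "valid_ids (L n) n f"
    by (auto simp: valid_ids_def)
  then show thesis ..
qed

lemma counter_lcl_lower_bound:
  assumes k: "k \<ge> 3" and p: "p = 2 * k" and L: "id_length L"
    and "solvable_in_rounds L (counter_lcl p) T"
    and n: "p * (2 ^ (k - 1) - 1) + 3 \<le> n"
  shows "2 ^ (k - 1) \<le> T n"
proof -
  obtain A where A: "solves L (counter_lcl p) T A"
    using assms(4) by (auto simp: solvable_in_rounds_def)
  have n1: "n \<ge> 1"
    using n by simp
  obtain ids where ids: "valid_ids (L n) n ids"
    using valid_ids_exist[OF L n1] .
  \<comment> \<open>The last position for which \<open>secret_forced\<close> applies.\<close>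
  define d where "d = p * (2 ^ (k - 1) - 2)"
  have k4: "(4::nat) \<le> 2 ^ (k - 1)"
    using power_increasing[of 2 "k - 1" "2::nat"] k by simp
  then have "Suc (2 ^ (k - 1) - 2) = (2 ^ (k - 1) - 1 :: nat)"
    by simp
  then have d: "d + p = p * (2 ^ (k - 1) - 1)"
    unfolding d_def by (metis mult_Suc_right add.commute)
  define out where "out s v = A n (neighbourhood (T n) n ids (secret_input p s) v)" for s v
  have "correct_output (counter_lcl p) n (secret_input p s) (out s)" for s
    using A ids n1 unfolding solves_def out_def
    by (auto simp: counter_lcl_def secret_input_def)
  then have out: "\<exists>(a::bool) (b::bool) i z. out s (d + 2) = to_nat (a, b, Carry s i z)" for s
    using k d n by (intro secret_forced[OF _ p refl]) auto
  have "out True (d + 2) \<noteq> out False (d + 2)"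
  proof -
    obtain a b a' b' :: bool and i z i' z' where
      "out True (d + 2) = to_nat (a, b, Carry True i z)"
      "out False (d + 2) = to_nat (a', b', Carry False i' z')"
      using out by meson
    then show ?thesis
      by (simp add: inj_eq[OF inj_to_nat])
  qed
  then have "neighbourhood (T n) n ids (secret_input p True) (d + 2) \<noteq>
             neighbourhood (T n) n ids (secret_input p False) (d + 2)"
    by (auto simp: out_def)
  \<comment> \<open>With the same identifiers, the two instances differ only at node 0, at distance
    \<open>d + 2\<close>.\<close>
  moreover have "neighbourhood (T n) n ids (secret_input p True) (d + 2) =
                 neighbourhood (T n) n ids (secret_input p False) (d + 2)" if "T n < d + 2"
    using that by (intro ext) (auto simp: neighbourhood_def node_info_at_def secret_input_def)
  ultimately have "d + 2 \<le> T n"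
    by fastforce
  moreover have "2 * (2 ^ (k - 1) - 2) \<le> d"
    unfolding d_def using k p by (intro mult_right_mono) auto
  ultimately show ?thesis
    using k4 by linarith
qed

theorem theorem4:
  "\<exists>c::real. c > 0 \<and>
     (\<forall>b::nat. \<exists>\<beta>\<ge>b. \<exists>P :: (nat, nat) lcl.
        beta_normalized \<beta> P \<and>
        (\<forall>L. id_length L \<longrightarrow>
           (\<exists>t::nat. solvable_in_rounds L P (\<lambda>n. t)) \<and>
           (\<forall>T. solvable_in_rounds L P T \<longrightarrow>
              (\<forall>\<^sub>F n in sequentially. 2 powr (c * real \<beta>) \<le> real (T n)))))"
proof (intro exI[of _ "1 / 100"] conjI allI)
  fix b :: nat
  define k where "k = b + 3"
  define p where "p = 2 * k"
  have k: "k \<ge> 3" "k > 0"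
    by (auto simp: k_def)
  have "\<forall>\<^sub>F n in sequentially. 2 powr (1 / 100 * real (24 * p + 4)) \<le> real (T n)"
    if L: "id_length L" and T: "solvable_in_rounds L (counter_lcl p) T" for L T
  proof (rule eventually_sequentiallyI)
    fix n assume "p * (2 ^ (k - 1) - 1) + 3 \<le> n"
    then have T: "2 ^ (k - 1) \<le> T n"
      by (rule counter_lcl_lower_bound[OF k(1) p_def L T])
    \<comment> \<open>With \<open>p = 2 * k\<close> the claim is
      \<open>48 * k + 4 \<le> 100 * (k - 1)\<close>, true from \<open>k = 2\<close> on.\<close>
    have "2 powr (1 / 100 * real (24 * p + 4)) \<le> 2 powr real (k - 1)"
      using k by (intro powr_mono) (auto simp: p_def of_nat_diff)
    also have "\<dots> = real (2 ^ (k - 1))"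
      by (simp add: powr_realpow)
    also have "\<dots> \<le> real (T n)"
      using T by (rule of_nat_mono)
    finally show "2 powr (1 / 100 * real (24 * p + 4)) \<le> real (T n)" .
  qed
  moreover have "b \<le> 24 * p + 4"
    by (simp add: p_def k_def)
  ultimately show "\<exists>\<beta>\<ge>b. \<exists>P :: (nat, nat) lcl.
        beta_normalized \<beta> P \<and>
        (\<forall>L. id_length L \<longrightarrow>
           (\<exists>t::nat. solvable_in_rounds L P (\<lambda>n. t)) \<and>
           (\<forall>T. solvable_in_rounds L P T \<longrightarrow>
              (\<forall>\<^sub>F n in sequentially. 2 powr (1 / 100 * real \<beta>) \<le> real (T n))))"
    using beta_normalized_counter_lcl[of p] solvable_counter_lcl[OF k(2) p_def]
    by (intro exI[of _ "24 * p + 4"], intro conjI exI[of _ "counter_lcl p"]) auto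
qed simp

end
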